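(* Let $X$ and $Y$ be measurable spaces such that either $X$ is countable and discrete or $Y$ is a standard Borel space. A kernel $\nu$ from $X$ to $Y$ is s-finite if and only if there exist a $\sigma$-finite kernel $\mu$ from $X$ to $Y$ and a jointly measurable function $f:X\times Y\to\{1,\infty\}$ such that $\nu=\mu\triangleright f$. Moreover, such a representation has the following uniqueness property: if $\nu=\mu\triangleright f=\mu'\triangleright f'$ with $\mu,\mu'$ $\sigma$-finite kernels from $X$ to $Y$ and $f,f':X\times Y\to\{1,\infty\}$ jointly measurable, then for all $x\in X$, $f(x,-)=f'(x,-)$ holds $\nu(x)$-almost everywhere, and for all $x\in X$ and $A\in\Sigma_Y$ such that $f(x,y)\neq\infty$ for every $y\in A$, we have $\mu(x,A)=\mu'(x,A)$.
   Context: A kernel from a measurable space $X$ to a measurable space $Y$ is a map $k:X\times\Sigma_Y\to[0,\infty]$ that is measurable in its first argument and a measure in its second; $k(x)$ denotes the measure $k(x,-)$. It is finite if $\sup_{x\in X}k(x,Y)<\infty$; s-finite if $k=\sum_{i\in\mathbb{N}}k_i$ with each $k_i$ a finite kernel from $X$ to $Y$; $\sigma$-finite if moreover the $k_i$ can be chosen pairwise mutually singular. For $C\in\Sigma_{X\times Y}$ write $C^x=\{y\mid (x,y)\in C\}$; $k$ is supported in $C$ if $k(x,Y\setminus C^x)=0$ for all $x$. Kernels $k,l$ from $X$ to $Y$ are mutually singular if there is $A\in\Sigma_{X\times Y}$ such that $k$ is supported in $A$ and $l$ is supported in $(X\times Y)\setminus A$. For a kernel $k$ from $X$ to $Y$ and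 measurable $f:X\times Y\to[0,\infty]$, $(k\triangleright f)(x,V):=\int_V k(x,\mathrm{d}y)\,f(x,y)$. Convention: $\infty\cdot 0=0$. A countable discrete space carries the $\sigma$-algebra of all subsets; a standard Borel space is a set with the Borel $\sigma$-algebra of some complete separable metric. *)

theory Defs
  imports "HOL-Analysis.Analysis"
begin

(* A kernel is only specified on space X: its values at points outside the carrier are junk, so
   all quantifications and equations below are relativised to x \<in> space X. *)
definition measure_kernel :: "'a measure \<Rightarrow> 'b measure \<Rightarrow> ('a \<Rightarrow> 'b measure) \<Rightarrow> bool" where
  "measure_kernel X Y k \<longleftrightarrow>
     (\<forall>x\<in>space X. sets (k x) = sets Y) \<and>
     (\<forall>B\<in>sets Y. (\<lambda>x. emeasure (k x) B) \<in> borel_measurable X)"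

definition finite_kernel :: "'a measure \<Rightarrow> 'b measure \<Rightarrow> ('a \<Rightarrow> 'b measure) \<Rightarrow> bool" where
  "finite_kernel X Y k \<longleftrightarrow>
     measure_kernel X Y k \<and> (SUP x\<in>space X. emeasure (k x) (space Y)) < \<infinity>"

definition kernel_sums ::
    "'a measure \<Rightarrow> 'b measure \<Rightarrow> (nat \<Rightarrow> 'a \<Rightarrow> 'b measure) \<Rightarrow> ('a \<Rightarrow> 'b measure) \<Rightarrow> bool" where
  "kernel_sums X Y ks k \<longleftrightarrow>
     (\<forall>x\<in>space X. \<forall>B\<in>sets Y. emeasure (k x) B = (\<Sum>i. emeasure (ks i x) B))"

definition kernel_supported_in ::
    "'a measure \<Rightarrow> 'b measure \<Rightarrow> ('a \<Rightarrow> 'b measure) \<Rightarrow> ('a \<times> 'b) set \<Rightarrow> bool" where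
  "kernel_supported_in X Y k C \<longleftrightarrow>
     (\<forall>x\<in>space X. emeasure (k x) (space Y - {y. (x, y) \<in> C}) = 0)"

definition mutually_singular_kernels ::
    "'a measure \<Rightarrow> 'b measure \<Rightarrow> ('a \<Rightarrow> 'b measure) \<Rightarrow> ('a \<Rightarrow> 'b measure) \<Rightarrow> bool" where
  "mutually_singular_kernels X Y k l \<longleftrightarrow>
     (\<exists>A\<in>sets (X \<Otimes>\<^sub>M Y).
        kernel_supported_in X Y k A \<and> kernel_supported_in X Y l (space X \<times> space Y - A))"

definition s_finite_kernel :: "'a measure \<Rightarrow> 'b measure \<Rightarrow> ('a \<Rightarrow> 'b measure) \<Rightarrow> bool" where
  "s_finite_kernel X Y k \<longleftrightarrow>
     measure_kernel X Y k \<and>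
     (\<exists>ks. (\<forall>i. finite_kernel X Y (ks i)) \<and> kernel_sums X Y ks k)"

definition sigma_finite_kernel :: "'a measure \<Rightarrow> 'b measure \<Rightarrow> ('a \<Rightarrow> 'b measure) \<Rightarrow> bool" where
  "sigma_finite_kernel X Y k \<longleftrightarrow>
     measure_kernel X Y k \<and>
     (\<exists>ks. (\<forall>i. finite_kernel X Y (ks i)) \<and> kernel_sums X Y ks k \<and>
           (\<forall>i j. i \<noteq> j \<longrightarrow> mutually_singular_kernels X Y (ks i) (ks j)))"

(* The convention \<infinity> * 0 = 0 needed here is the one of the type ennreal. *)
definition kernel_density ::
    "('a \<Rightarrow> 'b measure) \<Rightarrow> ('a \<times> 'b \<Rightarrow> ennreal) \<Rightarrow> 'a \<Rightarrow> 'b measure" where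
  "kernel_density k f = (\<lambda>x. density (k x) (\<lambda>y. f (x, y)))"

definition countable_discrete_space :: "'a measure \<Rightarrow> bool" where
  "countable_discrete_space X \<longleftrightarrow> countable (space X) \<and> sets X = Pow (space X)"

(* Stated for the carrier set space Y and an abstract metric on it, rather than through the type
   class polish_space, so that Y need not be the borel space of a whole type. *)
definition standard_borel_space :: "'b measure \<Rightarrow> bool" where
  "standard_borel_space Y \<longleftrightarrow>
     (\<exists>m. mspace m = space Y \<and> mcomplete_of m \<and>
          (\<exists>D. countable D \<and> D \<subseteq> mspace m \<and> mtopology_of m closure_of D = mspace m) \<and>
          sets Y = sigma_sets (space Y) {U. openin (mtopology_of m) U})"

end

(* An s-finite kernel \<nu> = \<Sum>i. \<nu>_i is dominated by one finite kernel l (a weighted sum of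
   the \<nu>_i), and a jointly measurable Radon-Nikodym theorem gives \<nu> = l \<triangleright> g with g valued in [0, \<infinity>].
   Moving the infinite values of g into f leaves a finite density, whose slices {n \<le> g < n + 1} are
   finite and mutually singular. Conversely, f = 1 + \<infinity> \<cdot> 1_{f = \<infinity>} is a countable sum of bounded functions.
   For uniqueness, on {f = 1, f' = \<infinity>} the measure \<nu>(x) equals the \<sigma>-finite \<mu>(x) and takes only the
   values 0 and \<infinity>, so this set is null.

   Joint measurability of the density h of k(x) with respect to l(x): H = {h > q} maximises the
   signed measure k(x) - q l(x), with deficit \<integral>|h - q| dl(x) over the symmetric difference of H
   and any competitor. In a countable generating algebra, the first set that is within
   (1/2)^j of the supremum depends measurably on x, and by Borel-Cantelli the
   limit superior of these sets is H up to a null set and up to {h = q}. *)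
theory Submission
  imports Defs
begin

section \<open>Countably generated \<open>\<sigma>\<close>-algebras\<close>

text \<open>The balls of radius \<open>1 / Suc n\<close> around a countable dense set form a
  countable base, so every open set is a countable union of members of the base.\<close>

lemma standard_borel_space_countably_generated:
  assumes "standard_borel_space Y"
  obtains U :: "nat \<Rightarrow> 'b set" where "range U \<subseteq> Pow (space Y)" "sets Y = sigma_sets (space Y) (range U)"
proof -
  from assms obtain m D where m: "mspace m = space Y" and D: "countable D" "D \<subseteq> mspace m"
    "mtopology_of m closure_of D = mspace m"
    and Y: "sets Y = sigma_sets (space Y) {V. openin (mtopology_of m) V}"
    unfolding standard_borel_space_def by blast
  interpret Metric_space "mspace m" "mdist m" by simp
  \<comment> \<open>The empty set keeps \<open>G\<close> nonempty even over an empty space, so that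
    \<open>from_nat_into\<close> enumerates exactly \<open>G\<close> at the end.\<close>
  define G where "G = insert {} ((\<lambda>(d, n::nat). mball d (1 / Suc n)) ` (D \<times> UNIV))"
  have cG: "countable G" unfolding G_def using D(1) by auto
  have Gopen: "G \<subseteq> {V. openin (mtopology_of m) V}"
    unfolding G_def mtopology_of_def by auto
  have GY: "G \<subseteq> Pow (space Y)"
    using mball_subset_mspace unfolding G_def m by auto
  have open_G: "V \<in> sigma_sets (space Y) G" if V: "openin (mtopology_of m) V" for V
  proof -
    have balls: "\<exists>d n. d \<in> D \<and> x \<in> mball d (1 / Suc n) \<and> mball d (1 / Suc n) \<subseteq> V" if x: "x \<in> V" for x
    proof -
      from V x obtain r where r: "r > 0" "mball x r \<subseteq> V" and xm: "x \<in> mspace m"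
        unfolding mtopology_of_def openin_mtopology by blast
      \<comment> \<open>Passing from \<open>x\<close> to a dense point \<open>d\<close> and from
        \<open>d\<close> to a point of its ball costs \<open>1 / Suc n\<close> each time, hence half
        of \<open>r\<close>.\<close>
      obtain n :: nat where n: "1 / Suc n < r / 2"
        using r(1) by (meson half_gt_zero nat_approx_posE)
      have "x \<in> mtopology_of m closure_of D" using D(3) xm by simp
      then have "\<forall>r>0. \<exists>d\<in>D. d \<in> mball x r"
        unfolding mtopology_of_def metric_closure_of by blast
      then obtain d where d: "d \<in> D" "d \<in> mball x (1 / Suc n)"
        by (meson of_nat_0_less_iff zero_less_Suc zero_less_divide_1_iff)
      have "mball d (1 / Suc n) \<subseteq> mball x r"
      proof
        fix z assume z: "z \<in> mball d (1 / Suc n)"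
        have "mdist m x z \<le> mdist m x d + mdist m d z"
          using z d by (intro triangle) auto
        then show "z \<in> mball x r" using z d n by auto
      qed
      then show ?thesis using d r(2) commute by (intro exI[of _ d] exI[of _ n]) auto
    qed
    have "\<exists>B\<in>G. x \<in> B \<and> B \<subseteq> V" if "x \<in> V" for x
    proof -
      obtain d n where "d \<in> D" "x \<in> mball d (1 / Suc n)" "mball d (1 / Suc n) \<subseteq> V"
        using balls[OF \<open>x \<in> V\<close>] by blast
      then show ?thesis unfolding G_def by (intro bexI[of _ "mball d (1 / Suc n)"]) auto
    qed
    then have "V = \<Union>{B \<in> G. B \<subseteq> V}" by blast
    moreover have "\<Union>{B \<in> G. B \<subseteq> V} \<in> sigma_sets (space Y) G"
      using cG GY by (intro sigma_sets_UNION) (auto intro: countable_subset)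
    ultimately show ?thesis by simp
  qed
  have "sets Y = sigma_sets (space Y) G"
    unfolding Y using Gopen open_G GY
    by (intro antisym sigma_sets_subseteq sigma_sets_mono) auto
  moreover have "G \<noteq> {}" by (auto simp: G_def)
  ultimately show thesis using that[of "from_nat_into G"] GY cG by (simp add: range_from_nat_into)
qed

text \<open>Finite Boolean expressions in the generators enumerate the algebra they generate, which is
  therefore countable.\<close>

datatype set_term = Generator nat | Complement set_term | Join set_term set_term

instance set_term :: countable
  by countable_datatype

primrec term_set :: "'a set \<Rightarrow> (nat \<Rightarrow> 'a set) \<Rightarrow> set_term \<Rightarrow> 'a set" where
  "term_set \<Omega> U (Generator n) = U n"
| "term_set \<Omega> U (Complement t) = \<Omega> - term_set \<Omega> U t"
| "term_set \<Omega> U (Join s t) = term_set \<Omega> U s \<union> term_set \<Omega> U t"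

lemma term_set_in_sigma_sets:
  assumes "range U \<subseteq> Pow \<Omega>"
  shows "term_set \<Omega> U t \<in> sigma_sets \<Omega> (range U)"
proof -
  interpret sigma_algebra \<Omega> "sigma_sets \<Omega> (range U)"
    using assms by (rule sigma_algebra_sigma_sets)
  show ?thesis by (induction t) auto
qed

lemma term_set_finite_UN:
  "finite I \<Longrightarrow> I \<noteq> {} \<Longrightarrow> \<exists>s. term_set \<Omega> U s = (\<Union>i\<in>I. term_set \<Omega> U (t i))"
proof (induction I rule: finite_ne_induct)
  case (insert i I)
  then show ?case by (metis UN_insert term_set.simps(3))
qed auto

text \<open>The sets that can be approximated arbitrarily well by the algebra contain the generators
  and are closed under complement and countable union. For a union, continuity from below reduces to
  finitely many members up to half of the error, and the member of index i is approximated with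
  error (\<epsilon>/2) (1/2)^(i+1).\<close>

lemma term_set_approximation:
  assumes "finite_measure M" and U: "range U \<subseteq> Pow (space M)"
    and M: "sets M = sigma_sets (space M) (range U)"
    and "A \<in> sets M" and "\<epsilon> > 0"
  shows "\<exists>t. measure M (sym_diff A (term_set (space M) U t)) < \<epsilon>"
proof -
  interpret finite_measure M by fact
  define T where "T = term_set (space M) U"
  have T[measurable]: "T t \<in> sets M" for t
    unfolding T_def M using U by (rule term_set_in_sigma_sets)
  have TS: "T t \<subseteq> space M" for t using T sets.sets_into_space by blast
  from \<open>A \<in> sets M\<close> have "A \<in> sigma_sets (space M) (range U)" by (simp add: M)
  then have "\<forall>\<epsilon>>0. \<exists>t. measure M (sym_diff A (T t)) < \<epsilon>"
  proof (induction rule: sigma_sets.induct)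
    case (Basic a)
    then obtain n where "a = T (Generator n)" by (auto simp: T_def)
    then show ?case by (metis Diff_cancel Un_absorb measure_empty)
  next
    case Empty
    \<comment> \<open>\<open>set_term\<close> has no constant for the empty set, so it is written as
      the complement of t joined with its own complement.\<close>
    have "T (Complement (Join t (Complement t))) = {}" for t using TS by (auto simp: T_def)
    then show ?case by (metis Diff_cancel Un_absorb measure_empty)
  next
    case (Compl a)
    have a: "a \<subseteq> space M" using Compl.hyps U by (metis sigma_sets_into_sp)
    have "sym_diff (space M - a) (T (Complement t)) = sym_diff a (T t)" for t
      using a TS[of t] unfolding T_def by auto
    then show ?case using Compl.IH by metis
  next
    case (Union a)
    show ?case
    proof (intro allI impI)
      fix \<epsilon> :: real assume \<epsilon>: "\<epsilon> > 0"
      have [measurable]: "a i \<in> sets M" for i using Union.hyps M by simp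
      have "\<exists>t. measure M (sym_diff (a i) (T t)) < (\<epsilon>/2) * (1/2) ^ Suc i" for i
      proof -
        have "0 < (\<epsilon>/2) * (1/2) ^ Suc i" using \<epsilon> by simp
        with Union.IH[of i] show ?thesis by blast
      qed
      then obtain t where t: "\<And>i. measure M (sym_diff (a i) (T (t i))) < (\<epsilon>/2) * (1/2) ^ Suc i"
        by metis
      have "(\<lambda>n. measure M (\<Union>i<n. a i)) \<longlonglongrightarrow> measure M (\<Union>n. \<Union>i<n. a i)"
        by (intro finite_Lim_measure_incseq) (auto simp: incseq_def intro: less_le_trans)
      moreover have "(\<Union>n. \<Union>i<n. a i) = (\<Union>i. a i)" by auto
      ultimately have "\<forall>\<^sub>F n in sequentially. measure M (\<Union>i<n. a i) > measure M (\<Union>i. a i) - \<epsilon>/2"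
        using \<epsilon> by (intro order_tendstoD(1)) auto
      \<comment> \<open>A positive \<open>n\<close> makes the finite union nonempty, as
        \<open>term_set_finite_UN\<close> requires.\<close>
      then have "\<exists>n>0. measure M (\<Union>i<n. a i) > measure M (\<Union>i. a i) - \<epsilon>/2"
        using eventually_conj[OF _ eventually_gt_at_top[of 0]]
        by (metis (mono_tags, lifting) eventually_happens trivial_limit_sequentially)
      then obtain n where n: "n > 0" "measure M (\<Union>i<n. a i) > measure M (\<Union>i. a i) - \<epsilon>/2" by blast
      obtain s where s: "T s = (\<Union>i<n. T (t i))"
        using term_set_finite_UN[of "{..<n}" "space M" U t] n(1) unfolding T_def by auto
      let ?R = "(\<Union>i. a i) - (\<Union>i<n. a i)" and ?D = "\<lambda>i. sym_diff (a i) (T (t i))"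
      have "measure M (sym_diff (\<Union>i. a i) (T s)) \<le> measure M (?R \<union> (\<Union>i<n. ?D i))"
        unfolding s by (intro finite_measure_mono) auto
      also have "\<dots> \<le> measure M ?R + measure M (\<Union>i<n. ?D i)"
        by (intro measure_Un_le) auto
      also have "measure M (\<Union>i<n. ?D i) \<le> (\<Sum>i<n. measure M (?D i))"
        by (intro measure_UNION_le) auto
      also have "\<dots> \<le> (\<Sum>i<n. (\<epsilon>/2) * (1/2) ^ Suc i)"
        by (intro sum_mono less_imp_le t)
      also have "\<dots> = (\<epsilon>/2) * (\<Sum>i<n. (1/2) ^ Suc i)" by (simp only: sum_distrib_left)
      also have "\<dots> \<le> (\<epsilon>/2) * 1"
        using \<epsilon> sum_le_suminf[of "\<lambda>n. (1/2::real) ^ Suc n" "{..<n}"] power_half_series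
        by (intro mult_left_mono) (auto simp: sums_iff)
      also have "measure M ?R = measure M (\<Union>i. a i) - measure M (\<Union>i<n. a i)"
        by (intro finite_measure_Diff) auto
      finally show "\<exists>s. measure M (sym_diff (\<Union>i. a i) (T s)) < \<epsilon>"
        using n(2) by (intro exI[of _ s]) auto
    qed
  qed
  then show ?thesis using \<open>\<epsilon> > 0\<close> unfolding T_def by blast
qed

section \<open>Kernels, integrals and densities\<close>

lemma measure_kernel_sets: "measure_kernel X Y k \<Longrightarrow> x \<in> space X \<Longrightarrow> sets (k x) = sets Y"
  by (simp add: measure_kernel_def)

lemma measure_kernel_space: "measure_kernel X Y k \<Longrightarrow> x \<in> space X \<Longrightarrow> space (k x) = space Y"
  by (intro sets_eq_imp_space_eq measure_kernel_sets)

lemma measure_kernel_measurable: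
  "measure_kernel X Y k \<Longrightarrow> B \<in> sets Y \<Longrightarrow> (\<lambda>x. emeasure (k x) B) \<in> borel_measurable X"
  by (simp add: measure_kernel_def)

lemma measurable_kernel_section:
  assumes "measure_kernel X Y k" "f \<in> measurable (X \<Otimes>\<^sub>M Y) N" "x \<in> space X"
  shows "(\<lambda>y. f (x, y)) \<in> measurable (k x) N"
  unfolding measurable_cong_sets[OF measure_kernel_sets[OF assms(1,3)] refl]
  using assms(2,3) by measurable

lemma finite_kernel_iff:
  "finite_kernel X Y k \<longleftrightarrow>
     measure_kernel X Y k \<and> (\<exists>c::real. \<forall>x\<in>space X. emeasure (k x) (space Y) \<le> ennreal c)"
proof -
  have "(SUP x\<in>space X. emeasure (k x) (space Y)) < \<infinity> \<longleftrightarrow>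
      (\<exists>c::real. \<forall>x\<in>space X. emeasure (k x) (space Y) \<le> ennreal c)"
  proof
    assume "(SUP x\<in>space X. emeasure (k x) (space Y)) < \<infinity>"
    then obtain c where "(SUP x\<in>space X. emeasure (k x) (space Y)) = ennreal c"
      by (metis infinity_ennreal_def less_top_ennreal)
    then show "\<exists>c::real. \<forall>x\<in>space X. emeasure (k x) (space Y) \<le> ennreal c"
      by (metis SUP_upper)
  next
    assume "\<exists>c::real. \<forall>x\<in>space X. emeasure (k x) (space Y) \<le> ennreal c"
    then obtain c :: real where "(SUP x\<in>space X. emeasure (k x) (space Y)) \<le> ennreal c"
      by (auto intro: SUP_least)
    then show "(SUP x\<in>space X. emeasure (k x) (space Y)) < \<infinity>"
      using le_less_trans[OF _ ennreal_less_top] by auto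
  qed
  then show ?thesis by (simp add: finite_kernel_def)
qed

lemma finite_kernel_finite_measure:
  assumes "finite_kernel X Y k" "x \<in> space X"
  shows "finite_measure (k x)"
proof
  have "measure_kernel X Y k" using assms(1) by (simp add: finite_kernel_def)
  then have "space (k x) = space Y" using assms(2) by (rule measure_kernel_space)
  moreover obtain c :: real where "emeasure (k x) (space Y) \<le> ennreal c"
    using assms unfolding finite_kernel_iff by blast
  ultimately show "emeasure (k x) (space (k x)) \<noteq> \<infinity>"
    using neq_top_trans[OF ennreal_neq_top] by simp
qed

text \<open>Dynkin's argument, starting from the rectangles. Finiteness of \<open>k x\<close> turns
  the measure of a complement into a difference.\<close>

lemma finite_kernel_emeasure_section_measurable:
  assumes k: "finite_kernel X Y k" and "C \<in> sets (X \<Otimes>\<^sub>M Y)"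
  shows "(\<lambda>x. emeasure (k x) (Pair x -` C)) \<in> borel_measurable X"
proof -
  have mk: "measure_kernel X Y k" using k by (simp add: finite_kernel_def)
  note [measurable] = measure_kernel_measurable[OF mk]
  have S: "sets (k x) = sets Y" "space (k x) = space Y" if "x \<in> space X" for x
    using measure_kernel_sets[OF mk that] measure_kernel_space[OF mk that] by auto
  from \<open>C \<in> sets (X \<Otimes>\<^sub>M Y)\<close> show ?thesis unfolding sets_pair_measure
  proof (induction rule: sigma_sets_induct_disjoint[OF Int_stable_pair_measure_generator
        pair_measure_closed, consumes 1, case_names basic empty compl union])
    case (basic C)
    then obtain A B where AB: "A \<in> sets X" "B \<in> sets Y" "C = A \<times> B" by auto
    have "emeasure (k x) (Pair x -` C) = emeasure (k x) B * indicator A x" for x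
      unfolding AB by (auto simp: indicator_def)
    then show ?case using AB by simp
  next
    case empty
    then show ?case by simp
  next
    case (compl C)
    have C[measurable]: "C \<in> sets (X \<Otimes>\<^sub>M Y)" using compl.hyps unfolding sets_pair_measure .
    have "emeasure (k x) (Pair x -` (space X \<times> space Y - C)) =
        emeasure (k x) (space Y) - emeasure (k x) (Pair x -` C)" if x: "x \<in> space X" for x
    proof -
      interpret finite_measure "k x" using finite_kernel_finite_measure[OF k x] .
      have "Pair x -` (space X \<times> space Y - C) = space (k x) - Pair x -` C" using x S by auto
      moreover have "Pair x -` C \<in> sets (k x)" using sets_Pair1[OF C] S(1)[OF x] by simp
      ultimately show ?thesis using emeasure_compl[of "Pair x -` C" "k x"] S(2)[OF x] by simp
    qed
    then show ?case using compl.IH by (simp cong: measurable_cong)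
  next
    case (union C)
    have C: "C i \<in> sets (X \<Otimes>\<^sub>M Y)" for i using union.hyps unfolding sets_pair_measure by auto
    have "emeasure (k x) (Pair x -` (\<Union>i. C i)) = (\<Sum>i. emeasure (k x) (Pair x -` C i))"
      if x: "x \<in> space X" for x
    proof -
      have "range (\<lambda>i. Pair x -` C i) \<subseteq> sets (k x)" using C S(1)[OF x] by (auto intro: sets_Pair1)
      moreover have "disjoint_family (\<lambda>i. Pair x -` C i)"
        using \<open>disjoint_family C\<close> by (fastforce simp: disjoint_family_on_def)
      ultimately show ?thesis by (simp add: vimage_UN suminf_emeasure)
    qed
    then show ?case using union.IH by (simp cong: measurable_cong)
  qed
qed

lemma finite_kernel_nn_integral_measurable:
  assumes k: "finite_kernel X Y k" and "f \<in> borel_measurable (X \<Otimes>\<^sub>M Y)"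
  shows "(\<lambda>x. \<integral>\<^sup>+y. f (x, y) \<partial>k x) \<in> borel_measurable X"
  using assms(2)
proof (induction rule: borel_measurable_induct)
  have mk: "measure_kernel X Y k" using k by (simp add: finite_kernel_def)
  note sec = measurable_kernel_section[OF mk]
  {
    case (cong f g)
    have "(\<integral>\<^sup>+y. f (x, y) \<partial>k x) = (\<integral>\<^sup>+y. g (x, y) \<partial>k x)" if "x \<in> space X" for x
      using cong.hyps(3) that measure_kernel_space[OF mk that]
      by (intro nn_integral_cong) (auto simp: space_pair_measure)
    then show ?case using cong.IH cong.hyps by (simp cong: measurable_cong)
  next
    case (set C)
    have "(\<integral>\<^sup>+y. indicator C (x, y) \<partial>k x) = emeasure (k x) (Pair x -` C)" if "x \<in> space X" for x
    proof -
      have "Pair x -` C \<in> sets (k x)"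
        using set measure_kernel_sets[OF mk that] by (auto intro: sets_Pair1)
      then show ?thesis by (simp flip: nn_integral_indicator) (simp add: indicator_def)
    qed
    then show ?case
      using finite_kernel_emeasure_section_measurable[OF k set] by (simp cong: measurable_cong)
  next
    case (mult f c)
    then show ?case by (simp add: nn_integral_cmult sec cong: measurable_cong)
  next
    case (add f g)
    then show ?case by (simp add: nn_integral_add sec cong: measurable_cong)
  next
    case (seq U)
    have "(\<integral>\<^sup>+y. (SUP i. U i) (x, y) \<partial>k x) = (SUP i. \<integral>\<^sup>+y. U i (x, y) \<partial>k x)" if "x \<in> space X" for x
      unfolding SUP_apply using seq.hyps(3) sec[OF seq.hyps(1) that]
      by (intro nn_integral_monotone_convergence_SUP) (auto simp: incseq_def le_fun_def)
    then show ?case using seq.IH by (simp cong: measurable_cong)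
  }
qed

lemma emeasure_kernel_density:
  assumes "measure_kernel X Y k" "f \<in> borel_measurable (X \<Otimes>\<^sub>M Y)" "x \<in> space X" "B \<in> sets Y"
  shows "emeasure (kernel_density k f x) B = (\<integral>\<^sup>+y. f (x, y) * indicator B y \<partial>k x)"
  unfolding kernel_density_def
  by (rule emeasure_density) (use assms measure_kernel_sets[OF assms(1,3)] in \<open>auto intro: measurable_kernel_section\<close>)

lemma measure_kernel_density:
  assumes k: "finite_kernel X Y k" and f: "f \<in> borel_measurable (X \<Otimes>\<^sub>M Y)"
  shows "measure_kernel X Y (kernel_density k f)"
  unfolding measure_kernel_def
proof (intro conjI ballI)
  have mk: "measure_kernel X Y k" using k by (simp add: finite_kernel_def)
  show "sets (kernel_density k f x) = sets Y" if "x \<in> space X" for x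
    using measure_kernel_sets[OF mk that] by (simp add: kernel_density_def)
  fix B assume B[measurable]: "B \<in> sets Y"
  have "(\<lambda>p. f p * indicator B (snd p)) \<in> borel_measurable (X \<Otimes>\<^sub>M Y)"
    using f by measurable
  from finite_kernel_nn_integral_measurable[OF k this]
  show "(\<lambda>x. emeasure (kernel_density k f x) B) \<in> borel_measurable X"
    by (simp add: emeasure_kernel_density[OF mk f _ B] cong: measurable_cong)
qed

lemma finite_kernel_density:
  assumes k: "finite_kernel X Y k" and f: "f \<in> borel_measurable (X \<Otimes>\<^sub>M Y)"
    and c: "\<And>x y. x \<in> space X \<Longrightarrow> y \<in> space Y \<Longrightarrow> f (x, y) \<le> ennreal c"
  shows "finite_kernel X Y (kernel_density k f)"
proof -
  have mk: "measure_kernel X Y k" using k by (simp add: finite_kernel_def)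
  obtain d :: real where d: "\<forall>x\<in>space X. emeasure (k x) (space Y) \<le> ennreal d"
    using k unfolding finite_kernel_iff by auto
  \<comment> \<open>The real bounds \<open>c\<close> and \<open>d\<close> may be negative, where
    \<open>ennreal\<close> returns 0. The maxima leave \<open>ennreal\<close> of the bounds
    unchanged and allow it to be multiplied through.\<close>
  have "emeasure (kernel_density k f x) (space Y) \<le> ennreal (max c 0 * max d 0)" if x: "x \<in> space X" for x
  proof -
    have "emeasure (kernel_density k f x) (space Y) \<le> (\<integral>\<^sup>+y. ennreal c \<partial>k x)"
      unfolding emeasure_kernel_density[OF mk f x sets.top] using c[OF x] measure_kernel_space[OF mk x]
      by (intro nn_integral_mono) (auto simp: indicator_def)
    also have "\<dots> = ennreal c * emeasure (k x) (space Y)" using measure_kernel_space[OF mk x] by simp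
    also have "\<dots> \<le> ennreal (max c 0) * ennreal (max d 0)"
      using d x by (intro mult_mono) (auto intro!: ennreal_leI order_trans[OF bspec[OF d x]])
    finally show ?thesis by (simp add: ennreal_mult)
  qed
  then show ?thesis using measure_kernel_density[OF k f] unfolding finite_kernel_iff by blast
qed

section \<open>Countable sums of measures and integration against them\<close>

lemma suminf_measure_exists:
  fixes M :: "nat \<Rightarrow> 'b measure"
  assumes S: "\<And>i. sets (M i) = sets Y"
  obtains N where "sets N = sets Y" "\<And>B. B \<in> sets Y \<Longrightarrow> emeasure N B = (\<Sum>i. emeasure (M i) B)"
proof -
  define N where "N = measure_of (space Y) (sets Y) (\<lambda>B. \<Sum>i. emeasure (M i) B)"
  have "sets N = sets Y" by (simp add: N_def)
  moreover have "emeasure N B = (\<Sum>i. emeasure (M i) B)" if "B \<in> sets Y" for B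
    unfolding N_def
  proof (rule emeasure_measure_of_sigma[OF _ _ _ that])
    show "countably_additive (sets Y) (\<lambda>B. \<Sum>i. emeasure (M i) B)"
    proof (rule countably_additiveI)
      fix A :: "nat \<Rightarrow> 'b set" assume A: "range A \<subseteq> sets Y" "disjoint_family A"
      \<comment> \<open>Countable additivity is an exchange of two nonnegative sums. Reading the
        outer one as an integral over the counting measure lets \<open>nn_integral_suminf\<close>
        exchange them.\<close>
      have "(\<Sum>j. \<Sum>i. emeasure (M i) (A j)) = (\<Sum>i. \<Sum>j. emeasure (M i) (A j))"
        unfolding nn_integral_count_space_nat[symmetric, of "\<lambda>j. \<Sum>i. emeasure (M i) (A j)"]
        by (subst nn_integral_suminf) (simp_all add: nn_integral_count_space_nat)
      then show "(\<Sum>j. \<Sum>i. emeasure (M i) (A j)) = (\<Sum>i. emeasure (M i) (\<Union>(range A)))"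
        using A S by (simp add: suminf_emeasure)
    qed
  qed (auto simp: positive_def intro: sets.sigma_algebra_axioms)
  ultimately show thesis using that by blast
qed

lemma nn_integral_suminf_measure:
  assumes S: "\<And>i. sets (M i) = sets N" and E: "\<And>B. B \<in> sets N \<Longrightarrow> emeasure N B = (\<Sum>i. emeasure (M i) B)"
    and "f \<in> borel_measurable N"
  shows "(\<integral>\<^sup>+y. f y \<partial>N) = (\<Sum>i. \<integral>\<^sup>+y. f y \<partial>M i)"
  using assms(3)
proof (induction rule: borel_measurable_induct)
  note [measurable_cong] = S
  {
    case (cong f g)
    have "(\<integral>\<^sup>+y. f y \<partial>M i) = (\<integral>\<^sup>+y. g y \<partial>M i)" for i
      using cong.hyps(3) sets_eq_imp_space_eq[OF S] by (intro nn_integral_cong) auto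
    then show ?case using cong by (simp cong: nn_integral_cong)
  next
    case (set A)
    then show ?case using S E by simp
  next
    case (mult f c)
    note [measurable] = mult.hyps(2)
    have "f \<in> borel_measurable (M i)" for i by measurable
    then show ?case using mult by (simp add: nn_integral_cmult)
  next
    case (add f g)
    note [measurable] = add.hyps(1,3)
    have "f \<in> borel_measurable (M i)" "g \<in> borel_measurable (M i)" for i by measurable
    then show ?case using add by (simp add: nn_integral_add suminf_add)
  next
    case (seq U)
    note [measurable] = seq.hyps(1)
    have U: "U j \<in> borel_measurable (M i)" for i j by measurable
    have "(\<integral>\<^sup>+y. (SUP j. U j) y \<partial>N) = (SUP j. \<Sum>i. \<integral>\<^sup>+y. U j y \<partial>M i)"
      unfolding SUP_apply using seq by (subst nn_integral_monotone_convergence_SUP) auto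
    also have "\<dots> = (\<Sum>i. SUP j. \<integral>\<^sup>+y. U j y \<partial>M i)"
      using seq.hyps(3)
      by (intro ennreal_suminf_SUP_eq[symmetric]) (auto simp: incseq_def le_fun_def intro!: nn_integral_mono)
    also have "\<dots> = (\<Sum>i. \<integral>\<^sup>+y. (SUP j. U j) y \<partial>M i)"
      unfolding SUP_apply using U seq.hyps(3) by (subst nn_integral_monotone_convergence_SUP) auto
    finally show ?case .
  }
qed

section \<open>A Radon-Nikodym theorem for finite kernels\<close>

text \<open>The kernel \<open>l\<close> is a weighted sum of the \<open>ks i\<close>. Its weights
  are small enough to give total mass at most 1, and strictly positive, so a null set of
  \<open>l x\<close> is null for every \<open>ks i x\<close>.\<close>

lemma dominating_finite_kernel:
  assumes ks: "\<And>i::nat. finite_kernel X Y (ks i)"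
  obtains l where "finite_kernel X Y l"
    "\<And>i x. x \<in> space X \<Longrightarrow> absolutely_continuous (l x) (ks i x)"
proof -
  have mk: "measure_kernel X Y (ks i)" for i using ks by (simp add: finite_kernel_def)
  have "\<exists>c\<ge>1. \<forall>x\<in>space X. emeasure (ks i x) (space Y) \<le> ennreal c" for i
  proof -
    obtain c :: real where c: "\<forall>x\<in>space X. emeasure (ks i x) (space Y) \<le> ennreal c"
      using ks[of i] unfolding finite_kernel_iff by blast
    have "ennreal c \<le> ennreal (max c 1)" by (intro ennreal_leI) simp
    then show ?thesis using c by (intro exI[of _ "max c 1"]) (auto intro: order_trans)
  qed
  then obtain c where c: "\<And>i. c i \<ge> 1"
    "\<And>i x. x \<in> space X \<Longrightarrow> emeasure (ks i x) (space Y) \<le> ennreal (c i)" by metis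
  \<comment> \<open>Dividing by a bound \<open>c i\<close> of the mass of \<open>ks i\<close> leaves
    at most (1/2)^(i+1) in the i-th summand. The choice \<open>c i \<ge> 1\<close> makes the
    division harmless.\<close>
  define w where "w i = ennreal ((1/2) ^ Suc i / c i)" for i
  have w0: "w i \<noteq> 0" for i
    using c(1)[of i] by (simp add: w_def ennreal_eq_0_iff not_le)
  have S: "sets (ks i x) = sets Y" if "x \<in> space X" for i x using measure_kernel_sets[OF mk that] .
  have "\<exists>N. sets N = sets Y \<and> (\<forall>B\<in>sets Y. emeasure N B = (\<Sum>i. w i * emeasure (ks i x) B))"
    if x: "x \<in> space X" for x
  proof (rule suminf_measure_exists[of "\<lambda>i. density (ks i x) (\<lambda>_. w i)" Y])
    fix N assume "sets N = sets Y"
      "\<And>B. B \<in> sets Y \<Longrightarrow> emeasure N B = (\<Sum>i. emeasure (density (ks i x) (\<lambda>_. w i)) B)"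
    then show ?thesis using S[OF x] by (auto simp: emeasure_density_const)
  qed (simp add: S[OF x])
  then obtain l where l: "\<And>x. x \<in> space X \<Longrightarrow> sets (l x) = sets Y"
    "\<And>x B. x \<in> space X \<Longrightarrow> B \<in> sets Y \<Longrightarrow> emeasure (l x) B = (\<Sum>i. w i * emeasure (ks i x) B)"
    by metis
  \<comment> \<open>The measures \<open>l x\<close> were chosen separately for each x. Measurability
    in x returns because the series formula determines their values.\<close>
  have "measure_kernel X Y l"
    unfolding measure_kernel_def
  proof (intro conjI ballI)
    fix B assume B: "B \<in> sets Y"
    note [measurable] = measure_kernel_measurable[OF mk B]
    show "(\<lambda>x. emeasure (l x) B) \<in> borel_measurable X" by (simp add: l(2) B cong: measurable_cong)
  qed (rule l(1))
  moreover have "emeasure (l x) (space Y) \<le> ennreal 1" if x: "x \<in> space X" for x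
  proof -
    have "w i * emeasure (ks i x) (space Y) \<le> ennreal ((1/2) ^ Suc i)" for i
    proof -
      have "w i * emeasure (ks i x) (space Y) \<le> w i * ennreal (c i)"
        by (intro mult_left_mono c(2) x) simp
      also have "\<dots> = ennreal ((1/2) ^ Suc i / c i * c i)"
        unfolding w_def using c(1)[of i] by (intro ennreal_mult[symmetric]) auto
      also have "(1/2) ^ Suc i / c i * c i = (1/2) ^ Suc i" using c(1)[of i] by simp
      finally show ?thesis .
    qed
    then have "(\<Sum>i. w i * emeasure (ks i x) (space Y)) \<le> (\<Sum>i. ennreal ((1/2) ^ Suc i))"
      by (intro suminf_le) auto
    also have "\<dots> = ennreal 1"
      using power_half_series by (intro suminf_ennreal_eq) auto
    finally show ?thesis using l(2)[OF x] by simp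
  qed
  ultimately have "finite_kernel X Y l" unfolding finite_kernel_iff by blast
  moreover have "absolutely_continuous (l x) (ks i x)" if x: "x \<in> space X" for i x
    unfolding absolutely_continuous_def
  proof
    fix B assume "B \<in> null_sets (l x)"
    then have "B \<in> sets Y" "emeasure (l x) B = 0" using l(1)[OF x] by auto
    then have B: "B \<in> sets Y" "(\<Sum>i. w i * emeasure (ks i x) B) = 0" using l(2)[OF x] by auto
    then have "w i * emeasure (ks i x) B = 0" by (subst (asm) suminf_eq_zero_iff) auto
    then show "B \<in> null_sets (ks i x)" using w0 B S[OF x] by auto
  qed
  ultimately show thesis using that by blast
qed

lemma measure_density_eq_integral:
  assumes f: "integrable M f" "\<And>x. 0 \<le> f x" and A: "A \<in> sets M"
  shows "measure (density M (\<lambda>x. ennreal (f x))) A = (\<integral>x. f x * indicator A x \<partial>M)"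
proof -
  have "emeasure (density M (\<lambda>x. ennreal (f x))) A = (\<integral>\<^sup>+x. ennreal (f x * indicator A x) \<partial>M)"
    using f A by (subst emeasure_density) (auto intro!: nn_integral_cong simp: indicator_def)
  also have "\<dots> = ennreal (\<integral>x. f x * indicator A x \<partial>M)"
    using f A by (intro nn_integral_eq_integral integrable_mult_indicator[where 'b = real, simplified, unfolded mult.commute[of "indicator _ _"]]) auto
  finally show ?thesis
    using f by (simp add: measure_def integral_nonneg_AE)
qed

text \<open>The set \<open>A\<close> is built from \<open>k\<close>, \<open>l\<close> and
  \<open>q\<close> alone and serves every x and every version \<open>h\<close> of the density at
  once, so no version has to be selected measurably in x. Points with \<open>h y = q\<close> are
  left undecided, because the signed measure k(x) - q l(x) has density 0 there.\<close>

lemma superlevel_set_jointly_measurable: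
  fixes q :: real
  assumes k: "finite_kernel X Y k" and l: "finite_kernel X Y l"
    and U: "range (U :: nat \<Rightarrow> 'b set) \<subseteq> Pow (space Y)" and Y: "sets Y = sigma_sets (space Y) (range U)"
  shows "\<exists>A\<in>sets (X \<Otimes>\<^sub>M Y). \<forall>x\<in>space X. \<forall>h\<in>borel_measurable (l x). (\<forall>y. 0 \<le> h y) \<longrightarrow>
      k x = density (l x) (\<lambda>y. ennreal (h y)) \<longrightarrow>
      (AE y in l x. h y \<noteq> q \<longrightarrow> ((x, y) \<in> A \<longleftrightarrow> q < h y))"
proof -
  have mk: "measure_kernel X Y k" and ml: "measure_kernel X Y l"
    using k l by (simp_all add: finite_kernel_def)
  define T :: "nat \<Rightarrow> 'b set" where "T n = term_set (space Y) U (from_nat n)" for n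
  have T[measurable]: "T n \<in> sets Y" for n
    unfolding T_def Y using U by (rule term_set_in_sigma_sets)
  \<comment> \<open>\<open>d x n\<close> is the value of the signed measure k(x) - q l(x) on the
    n-th set of the countable algebra. \<open>m j x\<close> is the first index that comes within
    (1/2)^j of the supremum; taking the least index makes the selection measurable in x.\<close>
  define d where "d x n = measure (k x) (T n) - q * measure (l x) (T n)" for x n
  define s where "s x = (SUP n. d x n)" for x
  define m where "m j x = (LEAST n. s x - (1/2) ^ j < d x n)" for j :: nat and x
  have d_meas[measurable]: "(\<lambda>x. d x n) \<in> borel_measurable X" for n
    using measure_kernel_measurable[OF mk T, of n] measure_kernel_measurable[OF ml T, of n]
    unfolding d_def measure_def by measurable
  have bdd: "bdd_above (range (d x))" if x: "x \<in> space X" for x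
  proof (rule bdd_aboveI2)
    interpret k: finite_measure "k x" using finite_kernel_finite_measure[OF k x] .
    interpret l: finite_measure "l x" using finite_kernel_finite_measure[OF l x] .
    fix n
    have "- q * measure (l x) (T n) \<le> \<bar>q\<bar> * measure (l x) (space (l x))"
      by (intro mult_mono l.bounded_measure) auto
    then show "d x n \<le> measure (k x) (space (k x)) + \<bar>q\<bar> * measure (l x) (space (l x))"
      using k.bounded_measure[of "T n"] unfolding d_def by simp
  qed
  have [measurable]: "s \<in> borel_measurable X"
    unfolding s_def using bdd by (intro borel_measurable_cSUP) auto
  have [measurable]: "m j \<in> measurable X (count_space UNIV)" for j
    unfolding m_def by measurable
  \<comment> \<open>The section of \<open>A\<close> at x is the limit superior of the sets
    \<open>T (m j x)\<close>. The extra quantifier over \<open>n\<close> splits membership into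
    countably many conditions, each with a fixed set \<open>T n\<close>, which shows joint
    measurability.\<close>
  define A where "A = {p \<in> space (X \<Otimes>\<^sub>M Y). \<forall>N. \<exists>j\<ge>N. \<exists>n. m j (fst p) = n \<and> snd p \<in> T n}"
  have "A \<in> sets (X \<Otimes>\<^sub>M Y)" unfolding A_def by measurable
  moreover have "AE y in l x. h y \<noteq> q \<longrightarrow> ((x, y) \<in> A \<longleftrightarrow> q < h y)"
    if x: "x \<in> space X" and h[measurable]: "h \<in> borel_measurable (l x)" and h0: "\<And>y. 0 \<le> h y"
      and kh: "k x = density (l x) (\<lambda>y. ennreal (h y))" for x h
  proof -
    interpret k: finite_measure "k x" using finite_kernel_finite_measure[OF k x] .
    interpret l: finite_measure "l x" using finite_kernel_finite_measure[OF l x] .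
    have S: "sets (l x) = sets Y" "space (l x) = space Y" "space (k x) = space Y"
      using measure_kernel_sets[OF ml x] measure_kernel_space[OF ml x] measure_kernel_space[OF mk x] by auto
    note [measurable_cong] = S(1)
    have "(\<integral>\<^sup>+y. ennreal (h y) \<partial>l x) = emeasure (k x) (space (k x))"
      using h by (simp add: kh emeasure_density cong: nn_integral_cong)
    then have h_int: "integrable (l x) h"
      using h0 by (intro integrableI_nonneg) (auto simp flip: top.not_eq_extremum)
    have hq_int: "integrable (l x) (\<lambda>y. h y - q)" "integrable (l x) (\<lambda>y. \<bar>h y - q\<bar>)"
      using h_int by auto
    have ind_int: "integrable (l x) (\<lambda>y. f y * indicator B y)"
      if "integrable (l x) f" "B \<in> sets Y" for f :: "'b \<Rightarrow> real" and B
      using integrable_mult_indicator[of B "l x" f] that S by (simp add: mult.commute)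
    \<comment> \<open>This finite measure records how much value of the signed measure is lost by
      replacing \<open>H\<close> with another set.\<close>
    define M where "M = density (l x) (\<lambda>y. ennreal \<bar>h y - q\<bar>)"
    have M: "sets M = sets Y" "space M = space Y" using S by (simp_all add: M_def)
    interpret M: finite_measure M
    proof
      have "emeasure M (space M) = (\<integral>\<^sup>+y. ennreal \<bar>h y - q\<bar> \<partial>l x)"
        by (simp add: M_def emeasure_density cong: nn_integral_cong)
      also have "\<dots> < \<infinity>" using hq_int(2) by (simp add: integrable_iff_bounded)
      finally show "emeasure M (space M) \<noteq> \<infinity>" by simp
    qed
    define H where "H = {y \<in> space Y. q < h y}"
    have H[measurable]: "H \<in> sets Y" unfolding H_def S(2)[symmetric] S(1)[symmetric] by measurable
    have D: "measure (k x) B - q * measure (l x) B = (\<integral>y. (h y - q) * indicator B y \<partial>l x)"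
      if B: "B \<in> sets Y" for B
    proof -
      have "measure (k x) B = (\<integral>y. h y * indicator B y \<partial>l x)"
        unfolding kh using h_int h0 B S by (intro measure_density_eq_integral) auto
      moreover have "q * measure (l x) B = (\<integral>y. q * indicator B y \<partial>l x)" using B S by simp
      ultimately show ?thesis
        using ind_int[OF h_int B] ind_int[of "\<lambda>_. q" B] B
        by (simp add: left_diff_distrib del: integral_mult_right_zero)
    qed
    \<comment> \<open>The difference of the two indicators is 1 on \<open>H - T n\<close>, where h -
      q is positive, and -1 on \<open>T n - H\<close>, where h - q is at most 0. Either way the
      integrand becomes |h - q|.\<close>
    have gap: "measure (k x) H - q * measure (l x) H - d x n = measure M (sym_diff H (T n))" for n
    proof -
      have "measure (k x) H - q * measure (l x) H - d x n =
          (\<integral>y. (h y - q) * indicator H y - (h y - q) * indicator (T n) y \<partial>l x)"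
        unfolding d_def D[OF H] D[OF T] by (intro Bochner_Integration.integral_diff[symmetric] ind_int hq_int T H)
      also have "\<dots> = (\<integral>y. \<bar>h y - q\<bar> * indicator (sym_diff H (T n)) y \<partial>l x)"
        using S by (intro Bochner_Integration.integral_cong) (auto simp: H_def indicator_def)
      also have "\<dots> = measure M (sym_diff H (T n))"
        unfolding M_def using hq_int(2) S by (intro measure_density_eq_integral[symmetric]) auto
      finally show ?thesis .
    qed
    \<comment> \<open>The supremum runs only over the countable algebra. It still reaches the value
      at \<open>H\<close>, since the algebra approximates \<open>H\<close> with respect to
      \<open>M\<close>.\<close>
    have "measure (k x) H - q * measure (l x) H \<le> s x"
    proof (rule field_le_epsilon)
      fix e :: real assume "0 < e"
      then obtain t where "measure M (sym_diff H (term_set (space Y) U t)) < e"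
        using term_set_approximation[OF M.finite_measure_axioms, of U H e] U H
        by (auto simp: M Y[symmetric])
      then have "measure M (sym_diff H (T (to_nat t))) < e" by (simp add: T_def)
      then have "measure (k x) H - q * measure (l x) H < d x (to_nat t) + e"
        unfolding gap[symmetric] by simp
      also have "d x (to_nat t) \<le> s x" unfolding s_def by (intro cSUP_upper bdd x) simp
      finally show "measure (k x) H - q * measure (l x) H \<le> s x + e" by simp
    qed
    moreover have "s x - (1/2) ^ j < d x (m j x)" for j
    proof -
      have "\<exists>n. s x - (1/2) ^ j < d x n"
        using less_cSUP_iff[OF _ bdd[OF x], of "s x - (1/2) ^ j"] unfolding s_def[symmetric] by auto
      then show ?thesis unfolding m_def by (rule LeastI_ex)
    qed
    ultimately have close: "measure M (sym_diff H (T (m j x))) < (1/2) ^ j" for j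
      unfolding gap[symmetric] by (smt (verit))
    \<comment> \<open>The errors (1/2)^j are summable, so by Borel-Cantelli almost every point lies
      in only finitely many of the symmetric differences.\<close>
    have "AE y in M. \<forall>\<^sub>F j in sequentially. y \<in> space M - sym_diff H (T (m j x))"
    proof (rule borel_cantelli_AE1)
      show "summable (\<lambda>j. measure M (sym_diff H (T (m j x))))"
        by (rule summable_comparison_test'[OF summable_geometric[of "1/2::real"], of 0])
          (use close in \<open>auto intro: less_imp_le\<close>)
    qed (use M in \<open>auto simp flip: top.not_eq_extremum\<close>)
    \<comment> \<open>A statement almost everywhere for \<open>M\<close> transfers to
      \<open>l x\<close> only where the density |h - q| is positive, which is where the condition
      \<open>h y \<noteq> q\<close> enters.\<close>
    then have "AE y in l x. 0 < ennreal \<bar>h y - q\<bar> \<longrightarrow>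
        (\<forall>\<^sub>F j in sequentially. y \<in> space M - sym_diff H (T (m j x)))"
      unfolding M_def by (subst (asm) AE_density) auto
    then show ?thesis
    proof (rule AE_mp, intro AE_I2 impI)
      fix y assume y: "y \<in> space (l x)" "h y \<noteq> q" and
        "0 < ennreal \<bar>h y - q\<bar> \<longrightarrow> (\<forall>\<^sub>F j in sequentially. y \<in> space M - sym_diff H (T (m j x)))"
      then obtain N where N: "\<And>j. j \<ge> N \<Longrightarrow> y \<in> H \<longleftrightarrow> y \<in> T (m j x)"
        by (auto simp: eventually_sequentially)
      have "(x, y) \<in> A \<longleftrightarrow> (\<forall>N. \<exists>j\<ge>N. y \<in> T (m j x))"
        using x y S by (auto simp: A_def space_pair_measure)
      also have "\<dots> \<longleftrightarrow> y \<in> H" using N by (meson nat_le_linear order_refl)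
      also have "\<dots> \<longleftrightarrow> q < h y" using y S by (simp add: H_def)
      finally show "(x, y) \<in> A \<longleftrightarrow> q < h y" .
    qed
  qed
  ultimately show ?thesis by (intro bexI[of _ A]) auto
qed

text \<open>A real number is the supremum of the rationals below it. A wrong answer of
  \<open>P\<close> at a rational equal to \<open>r\<close> does no damage, and negative rationals
  contribute \<open>ennreal\<close> value 0.\<close>

lemma SUP_rat_superlevel:
  fixes r :: real
  assumes "0 \<le> r" "\<And>q::rat. r \<noteq> of_rat q \<Longrightarrow> P q \<longleftrightarrow> of_rat q < r"
  shows "(SUP q::rat. if P q then ennreal (of_rat q) else 0) = ennreal r"
proof (rule antisym)
  show "(SUP q::rat. if P q then ennreal (of_rat q) else 0) \<le> ennreal r"
    using assms(2) by (intro SUP_least) (auto intro!: ennreal_leI, metis less_eq_real_def)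
  show "ennreal r \<le> (SUP q::rat. if P q then ennreal (of_rat q) else 0)"
  proof (rule dense_le)
    fix z assume z: "z < ennreal r"
    then obtain t where t: "z = ennreal t" "0 \<le> t"
      by (metis ennreal_cases ennreal_less_top less_trans order.asym top.not_eq_extremum)
    with z have "t < r" by (simp add: ennreal_less_iff)
    then obtain q where q: "t < of_rat q" "of_rat q < r" using of_rat_dense by blast
    then have "P q" using assms(2)[of q] by auto
    then have "ennreal (of_rat q) \<le> (SUP q::rat. if P q then ennreal (of_rat q) else 0)"
      by (intro SUP_upper2[of q]) auto
    moreover have "z \<le> ennreal (of_rat q)" using t q by (auto intro: ennreal_leI)
    ultimately show "z \<le> (SUP q::rat. if P q then ennreal (of_rat q) else 0)" by (rule order_trans[rotated])
  qed
qed

text \<open>Over a countable discrete X, joint measurability follows from that of the sections, so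
  the derivatives for the single x can be glued. Over a standard Borel Y, the density is reassembled
  from its superlevel sets at rational thresholds.\<close>

theorem kernel_Radon_Nikodym:
  assumes XY: "countable_discrete_space X \<or> standard_borel_space Y"
    and k: "finite_kernel X Y k" and l: "finite_kernel X Y l"
    and ac: "\<And>x. x \<in> space X \<Longrightarrow> absolutely_continuous (l x) (k x)"
  shows "\<exists>g\<in>borel_measurable (X \<Otimes>\<^sub>M Y). \<forall>x\<in>space X. k x = kernel_density l g x"
proof -
  have mk: "measure_kernel X Y k" and ml: "measure_kernel X Y l"
    using k l by (simp_all add: finite_kernel_def)
  have S: "sets (k x) = sets Y" "sets (l x) = sets Y" if "x \<in> space X" for x
    using measure_kernel_sets[OF mk that] measure_kernel_sets[OF ml that] by auto
  have RN: "density (l x) (RN_deriv (l x) (k x)) = k x" if x: "x \<in> space X" for x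
  proof -
    interpret finite_measure "l x" using finite_kernel_finite_measure[OF l x] .
    show ?thesis using ac[OF x] S[OF x] by (intro density_RN_deriv) auto
  qed
  from XY show ?thesis
  proof
    assume X: "countable_discrete_space X"
    define g where "g p = RN_deriv (l (fst p)) (k (fst p)) (snd p)" for p
    have "sets (X \<Otimes>\<^sub>M Y) = sets (count_space (space X) \<Otimes>\<^sub>M Y)"
      using X by (intro sets_pair_measure_cong) (auto simp: countable_discrete_space_def)
    moreover have "g \<in> borel_measurable (count_space (space X) \<Otimes>\<^sub>M Y)"
    proof (rule measurable_pair_measure_countable1)
      show "countable (space X)" using X by (simp add: countable_discrete_space_def)
      show "(\<lambda>y. g (x, y)) \<in> borel_measurable Y" if "x \<in> space X" for x
        unfolding g_def measurable_cong_sets[OF S(2)[OF that, symmetric] refl] by simp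
    qed
    ultimately have "g \<in> borel_measurable (X \<Otimes>\<^sub>M Y)" by (simp cong: measurable_cong_sets)
    then show ?thesis using RN by (intro bexI[of _ g]) (auto simp: kernel_density_def g_def)
  next
    assume "standard_borel_space Y"
    then obtain U :: "nat \<Rightarrow> 'b set" where U: "range U \<subseteq> Pow (space Y)" "sets Y = sigma_sets (space Y) (range U)"
      by (rule standard_borel_space_countably_generated)
    define P where "P q A \<longleftrightarrow> (\<forall>x\<in>space X. \<forall>h\<in>borel_measurable (l x). (\<forall>y. 0 \<le> h y) \<longrightarrow>
        k x = density (l x) (\<lambda>y. ennreal (h y)) \<longrightarrow>
        (AE y in l x. h y \<noteq> q \<longrightarrow> ((x, y) \<in> A \<longleftrightarrow> q < h y)))" for q A
    have "\<forall>q. \<exists>A. A \<in> sets (X \<Otimes>\<^sub>M Y) \<and> P q A"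
      unfolding P_def using superlevel_set_jointly_measurable[OF k l U] by blast
    then obtain A where A: "\<And>q. A q \<in> sets (X \<Otimes>\<^sub>M Y)" and P: "\<And>q. P q (A q)"
      by metis
    note [measurable] = A
    define g where "g p = (SUP q::rat. if p \<in> A (of_rat q) then ennreal (of_rat q) else 0)" for p
    have g: "g \<in> borel_measurable (X \<Otimes>\<^sub>M Y)" unfolding g_def by measurable
    have "k x = kernel_density l g x" if x: "x \<in> space X" for x
    proof -
      interpret finite_measure "l x" using finite_kernel_finite_measure[OF l x] .
      \<comment> \<open>Since \<open>k x\<close> is finite, its derivative has a real-valued
        version, as the lemma on superlevel sets demands.\<close>
      obtain h where h: "h \<in> borel_measurable (l x)"
        "AE y in l x. RN_deriv (l x) (k x) y = ennreal (h y)" "\<And>y. 0 \<le> h y"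
        using real_RN_deriv[OF finite_kernel_finite_measure[OF k x] ac[OF x]] S[OF x] by metis
      have "density (l x) (RN_deriv (l x) (k x)) = density (l x) (\<lambda>y. ennreal (h y))"
        using h by (intro density_cong) auto
      then have kh: "k x = density (l x) (\<lambda>y. ennreal (h y))" using RN[OF x] by simp
      \<comment> \<open>There is one exceptional null set per rational, and countably many of them
        are still null together.\<close>
      have "AE y in l x. \<forall>q::rat. h y \<noteq> of_rat q \<longrightarrow> ((x, y) \<in> A (of_rat q) \<longleftrightarrow> of_rat q < h y)"
        unfolding AE_all_countable using P x h(1,3) kh unfolding P_def by blast
      then have "AE y in l x. ennreal (h y) = g (x, y)"
        unfolding g_def
        by (rule AE_mp) (intro AE_I2 impI SUP_rat_superlevel[symmetric] h(3), blast)
      then show ?thesis unfolding kernel_density_def kh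
        using h(1) measurable_kernel_section[OF ml g x] by (intro density_cong) auto
    qed
    with g show ?thesis by blast
  qed
qed

section \<open>s-finite and \<open>\<sigma>\<close>-finite kernels\<close>

lemma s_finite_kernel_density:
  assumes m: "s_finite_kernel X Y \<mu>" and f: "f \<in> borel_measurable (X \<Otimes>\<^sub>M Y)"
    and f1: "f \<in> space (X \<Otimes>\<^sub>M Y) \<rightarrow> {1, \<infinity>}"
    and n: "measure_kernel X Y \<nu>" "\<And>x. x \<in> space X \<Longrightarrow> \<nu> x = kernel_density \<mu> f x"
  shows "s_finite_kernel X Y \<nu>"
proof -
  note [measurable] = f
  obtain ks where mm: "measure_kernel X Y \<mu>" and ks: "\<And>i. finite_kernel X Y (ks i)" "kernel_sums X Y ks \<mu>"
    using m unfolding s_finite_kernel_def by blast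
  have mk: "measure_kernel X Y (ks i)" for i using ks(1) by (simp add: finite_kernel_def)
  \<comment> \<open>\<open>F 0\<close> supplies the value 1 everywhere, and all later terms repeat
    the indicator of the infinite set, so the series is 1 where f is 1 and diverges where f is
    infinite. Each term is bounded by 1.\<close>
  define F :: "nat \<Rightarrow> 'a \<times> 'b \<Rightarrow> ennreal"
    where "F j = (if j = 0 then (\<lambda>_. 1) else indicator {p \<in> space (X \<Otimes>\<^sub>M Y). f p = \<infinity>})" for j
  have F[measurable]: "F j \<in> borel_measurable (X \<Otimes>\<^sub>M Y)" for j
    unfolding F_def by (cases "j = 0") simp_all
  have F_sum: "(\<Sum>j. F j p) = f p" if p: "p \<in> space (X \<Otimes>\<^sub>M Y)" for p
  proof (cases "f p = \<infinity>")
    case True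
    then have "(\<lambda>j. F j p) = (\<lambda>j. 1)" using p by (auto simp: F_def)
    then show ?thesis using True
      by (simp add: ennreal_suminf_neq_top flip: nn_integral_count_space_nat)
  next
    case False
    then have "(\<lambda>j. F j p) = (\<lambda>j. if j = 0 then 1 else 0)" by (auto simp: F_def)
    then show ?thesis using False f1 p suminf_finite[of "{0::nat}" "\<lambda>j. if j = 0 then 1 else (0::ennreal)"] by auto
  qed
  \<comment> \<open>The family of finite kernels indexed by pairs (i, j) is listed as one sequence
    by \<open>prod_decode\<close>.\<close>
  define ks' where "ks' n = (case prod_decode n of (i, j) \<Rightarrow> kernel_density (ks i) (F j))" for n
  have "finite_kernel X Y (ks' n)" for n
    unfolding ks'_def
    by (auto split: prod.split intro!: finite_kernel_density[where c = 1] ks F simp: F_def indicator_def)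
  moreover have "kernel_sums X Y ks' \<nu>"
    unfolding kernel_sums_def
  proof (intro ballI)
    fix x B assume x: "x \<in> space X" and B[measurable]: "B \<in> sets Y"
    have S: "sets (ks i x) = sets (\<mu> x)" for i
      using measure_kernel_sets[OF mk x] measure_kernel_sets[OF mm x] by simp
    have "(\<lambda>y. f (x, y) * indicator B y) \<in> borel_measurable (\<mu> x)"
      using measurable_kernel_section[OF mm f x] B measure_kernel_sets[OF mm x] by measurable
    then have "emeasure (\<nu> x) B = (\<Sum>i. \<integral>\<^sup>+y. f (x, y) * indicator B y \<partial>ks i x)"
      unfolding n(2)[OF x] emeasure_kernel_density[OF mm f x B]
      using ks(2) x measure_kernel_sets[OF mm x] S
      by (intro nn_integral_suminf_measure) (auto simp: kernel_sums_def)
    also have "\<dots> = (\<Sum>i. \<Sum>j. emeasure (kernel_density (ks i) (F j) x) B)"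
    proof (intro suminf_cong)
      fix i
      have "(\<lambda>y. F j (x, y) * indicator B y) \<in> borel_measurable (ks i x)" for j
        using measurable_kernel_section[OF mk F x] B measure_kernel_sets[OF mk x] by measurable
      then have "(\<Sum>j. \<integral>\<^sup>+y. F j (x, y) * indicator B y \<partial>ks i x) =
          (\<integral>\<^sup>+y. (\<Sum>j. F j (x, y) * indicator B y) \<partial>ks i x)"
        by (intro nn_integral_suminf[symmetric])
      also have "\<dots> = (\<integral>\<^sup>+y. f (x, y) * indicator B y \<partial>ks i x)"
        using x measure_kernel_space[OF mk x]
        by (intro nn_integral_cong) (simp add: F_sum space_pair_measure)
      finally show "(\<integral>\<^sup>+y. f (x, y) * indicator B y \<partial>ks i x) =
          (\<Sum>j. emeasure (kernel_density (ks i) (F j) x) B)"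
        by (simp add: emeasure_kernel_density[OF mk F x B])
    qed
    also have "\<dots> = (\<Sum>n. emeasure (ks' n x) B)"
      unfolding ks'_def
      using suminf_ennreal_2dimen[of "\<lambda>i. \<Sum>j. emeasure (kernel_density (ks i) (F j) x) B"
          "\<lambda>(i, j). emeasure (kernel_density (ks i) (F j) x) B"]
      by (simp add: case_prod_beta)
    finally show "emeasure (\<nu> x) B = (\<Sum>n. emeasure (ks' n x) B)" .
  qed
  ultimately show ?thesis unfolding s_finite_kernel_def using n(1) by blast
qed

lemma kernel_density_supported_in:
  assumes l: "measure_kernel X Y l" and g: "g \<in> borel_measurable (X \<Otimes>\<^sub>M Y)"
    and C: "C \<in> sets (X \<Otimes>\<^sub>M Y)"
    and 0: "\<And>x y. x \<in> space X \<Longrightarrow> y \<in> space Y \<Longrightarrow> (x, y) \<notin> C \<Longrightarrow> g (x, y) = 0"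
  shows "kernel_supported_in X Y (kernel_density l g) C"
  unfolding kernel_supported_in_def
proof
  fix x assume x: "x \<in> space X"
  have "{y. (x, y) \<in> C} \<in> sets Y" using sets_Pair1[OF C, of x] by (simp add: vimage_def)
  then have "space Y - {y. (x, y) \<in> C} \<in> sets Y" by auto
  from emeasure_kernel_density[OF l g x this]
  have "emeasure (kernel_density l g x) (space Y - {y. (x, y) \<in> C}) =
      (\<integral>\<^sup>+y. g (x, y) * indicator (space Y - {y. (x, y) \<in> C}) y \<partial>l x)" .
  also have "\<dots> = (\<integral>\<^sup>+y. 0 \<partial>l x)"
    using 0[OF x] by (intro nn_integral_cong) (auto simp: indicator_def)
  finally show "emeasure (kernel_density l g x) (space Y - {y. (x, y) \<in> C}) = 0" by simp
qed

text \<open>The slices on which the integer part of the density is n are pairwise disjoint. Cutting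
  the density along them gives mutually singular kernels, each with a bounded density with respect
  to a finite kernel.\<close>

lemma sigma_finite_kernel_density:
  assumes l: "finite_kernel X Y l" and g[measurable]: "g \<in> borel_measurable (X \<Otimes>\<^sub>M Y)"
    and fin: "\<And>p. p \<in> space (X \<Otimes>\<^sub>M Y) \<Longrightarrow> g p \<noteq> \<infinity>"
  shows "sigma_finite_kernel X Y (kernel_density l g)"
proof -
  have ml: "measure_kernel X Y l" using l by (simp add: finite_kernel_def)
  \<comment> \<open>\<open>enn2real\<close> maps infinity to 0 and would put infinite points into
    \<open>S 0\<close>; the assumption \<open>fin\<close> excludes them, and \<open>h_le\<close>
    relies on that.\<close>
  define S where "S n = {p \<in> space (X \<Otimes>\<^sub>M Y). nat \<lfloor>enn2real (g p)\<rfloor> = n}" for n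
  have S[measurable]: "S n \<in> sets (X \<Otimes>\<^sub>M Y)" for n unfolding S_def by measurable
  define h where "h n p = g p * indicator (S n) p" for n p
  have h[measurable]: "h n \<in> borel_measurable (X \<Otimes>\<^sub>M Y)" for n unfolding h_def by measurable
  have h_sum: "(\<Sum>n. h n p) = g p" if "p \<in> space (X \<Otimes>\<^sub>M Y)" for p
  proof -
    have "(\<Sum>n. h n p) = g p * (\<Sum>n. indicator (S n) p)" by (simp add: h_def)
    also have "(\<Sum>n. indicator (S n) p :: ennreal) = indicator (\<Union>n. S n) p"
      by (intro suminf_indicator) (auto simp: disjoint_family_on_def S_def)
    finally show ?thesis using that by (simp add: S_def)
  qed
  have h_le: "h n (x, y) \<le> ennreal (real n + 1)" if "x \<in> space X" "y \<in> space Y" for n x y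
  proof (cases "(x, y) \<in> S n")
    case True
    then have "enn2real (g (x, y)) \<le> real n + 1" "(x, y) \<in> space (X \<Otimes>\<^sub>M Y)"
      unfolding S_def by (simp_all, linarith)
    then have "g (x, y) \<le> ennreal (real n + 1)"
      using fin[of "(x, y)"] ennreal_enn2real[of "g (x, y)"] ennreal_leI
      by (metis infinity_ennreal_def top.not_eq_extremum)
    then show ?thesis by (simp add: h_def indicator_def)
  qed (simp add: h_def)
  have "kernel_sums X Y (\<lambda>n. kernel_density l (h n)) (kernel_density l g)"
    unfolding kernel_sums_def
  proof (intro ballI)
    fix x B assume x: "x \<in> space X" and B[measurable]: "B \<in> sets Y"
    have "(\<lambda>y. h n (x, y) * indicator B y) \<in> borel_measurable (l x)" for n
      using measurable_kernel_section[OF ml h x] B measure_kernel_sets[OF ml x] by measurable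
    then have "(\<Sum>n. \<integral>\<^sup>+y. h n (x, y) * indicator B y \<partial>l x) =
        (\<integral>\<^sup>+y. (\<Sum>n. h n (x, y) * indicator B y) \<partial>l x)"
      by (intro nn_integral_suminf[symmetric])
    also have "\<dots> = (\<integral>\<^sup>+y. g (x, y) * indicator B y \<partial>l x)"
      using x measure_kernel_space[OF ml x]
      by (intro nn_integral_cong) (simp add: h_sum space_pair_measure)
    finally show "emeasure (kernel_density l g x) B = (\<Sum>n. emeasure (kernel_density l (h n) x) B)"
      by (simp add: emeasure_kernel_density[OF ml _ x B] h g)
  qed
  moreover have "mutually_singular_kernels X Y (kernel_density l (h i)) (kernel_density l (h j))"
    if "i \<noteq> j" for i j
    unfolding mutually_singular_kernels_def
  proof (intro bexI[of _ "S i"] conjI kernel_density_supported_in ml h S)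
    show "space X \<times> space Y - S i \<in> sets (X \<Otimes>\<^sub>M Y)"
      unfolding space_pair_measure[symmetric] by measurable
  qed (use that in \<open>auto simp: h_def S_def indicator_def\<close>)
  moreover have "finite_kernel X Y (kernel_density l (h n))" for n
    using h_le by (intro finite_kernel_density[OF l h])
  ultimately show ?thesis
    unfolding sigma_finite_kernel_def
    by (intro conjI exI[of _ "\<lambda>n. kernel_density l (h n)"] allI impI measure_kernel_density[OF l g])
qed

lemma s_finite_kernel_decomposition:
  assumes XY: "countable_discrete_space X \<or> standard_borel_space Y"
    and "s_finite_kernel X Y \<nu>"
  shows "\<exists>\<mu> f. sigma_finite_kernel X Y \<mu> \<and>
      f \<in> borel_measurable (X \<Otimes>\<^sub>M Y) \<and> f \<in> space (X \<Otimes>\<^sub>M Y) \<rightarrow> {1, \<infinity>} \<and>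
      (\<forall>x\<in>space X. \<nu> x = kernel_density \<mu> f x)"
proof -
  obtain ks where n: "measure_kernel X Y \<nu>" and ks: "\<And>i. finite_kernel X Y (ks i)" "kernel_sums X Y ks \<nu>"
    using assms(2) unfolding s_finite_kernel_def by blast
  obtain l where l: "finite_kernel X Y l"
    and ac: "\<And>i x. x \<in> space X \<Longrightarrow> absolutely_continuous (l x) (ks i x)"
    using dominating_finite_kernel[of X Y ks] ks(1) by blast
  have ml: "measure_kernel X Y l" using l by (simp add: finite_kernel_def)
  \<comment> \<open>The Radon-Nikodym theorem covers finite kernels, so it is applied to each
    summand of \<open>\<nu>\<close>, and the resulting densities are added.\<close>
  have "\<forall>i. \<exists>g\<in>borel_measurable (X \<Otimes>\<^sub>M Y). \<forall>x\<in>space X. ks i x = kernel_density l g x"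
    using kernel_Radon_Nikodym[OF XY ks(1) l ac] by blast
  then obtain G where G[measurable]: "\<And>i. G i \<in> borel_measurable (X \<Otimes>\<^sub>M Y)"
    and ksG: "\<And>i x. x \<in> space X \<Longrightarrow> ks i x = kernel_density l (G i) x" by metis
  define g where "g p = (\<Sum>i. G i p)" for p
  \<comment> \<open>Where g is infinite, \<open>g'\<close> must be finite but not 0: then the
    product with f is infinite again, whereas the convention for infinity times 0 would lose the
    mass.\<close>
  define g' where "g' p = (if g p = \<infinity> then 1 else g p)" for p
  define f where "f p = (if g p = \<infinity> then \<infinity> else 1 :: ennreal)" for p
  have g[measurable]: "g \<in> borel_measurable (X \<Otimes>\<^sub>M Y)" unfolding g_def by measurable
  have g': "g' \<in> borel_measurable (X \<Otimes>\<^sub>M Y)" unfolding g'_def by measurable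
  have f: "f \<in> borel_measurable (X \<Otimes>\<^sub>M Y)" unfolding f_def by measurable
  have gg: "g' p * f p = g p" for p by (auto simp: g'_def f_def ennreal_mult_top)
  have "\<nu> x = kernel_density (kernel_density l g') f x" if x: "x \<in> space X" for x
  proof -
    have "\<nu> x = kernel_density l g x"
    proof (rule measure_eqI)
      show "sets (\<nu> x) = sets (kernel_density l g x)"
        using measure_kernel_sets[OF n x] measure_kernel_sets[OF ml x] by (simp add: kernel_density_def)
      fix B assume "B \<in> sets (\<nu> x)"
      then have B[measurable]: "B \<in> sets Y" using measure_kernel_sets[OF n x] by simp
      have "(\<lambda>y. G i (x, y) * indicator B y) \<in> borel_measurable (l x)" for i
        using measurable_kernel_section[OF ml G x] B measure_kernel_sets[OF ml x] by measurable
      then have "(\<Sum>i. \<integral>\<^sup>+y. G i (x, y) * indicator B y \<partial>l x) =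
          (\<integral>\<^sup>+y. (\<Sum>i. G i (x, y) * indicator B y) \<partial>l x)"
        by (intro nn_integral_suminf[symmetric])
      then show "emeasure (\<nu> x) B = emeasure (kernel_density l g x) B"
        using ks(2) x B
        by (simp add: kernel_sums_def ksG emeasure_kernel_density[OF ml _ x B] G g) (simp add: g_def)
    qed
    also have "\<dots> = kernel_density (kernel_density l g') f x"
      unfolding kernel_density_def using measurable_kernel_section[OF ml _ x] f g'
      by (subst density_density_eq) (auto simp: gg)
    finally show ?thesis .
  qed
  moreover have "sigma_finite_kernel X Y (kernel_density l g')"
    by (intro sigma_finite_kernel_density l g') (simp add: g'_def)
  moreover have "f \<in> space (X \<Otimes>\<^sub>M Y) \<rightarrow> {1, \<infinity>}" by (auto simp: f_def)
  ultimately show ?thesis using f by blast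
qed

lemma sigma_finite_kernel_imp_s_finite_kernel:
  "sigma_finite_kernel X Y k \<Longrightarrow> s_finite_kernel X Y k"
  unfolding sigma_finite_kernel_def s_finite_kernel_def by blast

text \<open>For fixed x, mutual singularity yields sets \<open>E i\<close> on which all summands
  except \<open>ks i x\<close> vanish, so \<open>\<mu> x\<close> is finite there. What remains
  outside all \<open>E i\<close> is null for every summand.\<close>

lemma sigma_finite_kernel_sigma_finite_measure:
  assumes "sigma_finite_kernel X Y \<mu>" and x: "x \<in> space X"
  shows "sigma_finite_measure (\<mu> x)"
proof -
  obtain ks where m: "measure_kernel X Y \<mu>" and ks: "\<And>i. finite_kernel X Y (ks i)"
    and sums: "kernel_sums X Y ks \<mu>"
    and sing: "\<And>i j. i \<noteq> j \<Longrightarrow> mutually_singular_kernels X Y (ks i) (ks j)"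
    using assms(1) unfolding sigma_finite_kernel_def by blast
  have mk: "measure_kernel X Y (ks i)" for i using ks by (simp add: finite_kernel_def)
  have S: "sets (\<mu> x) = sets Y" "space (\<mu> x) = space Y" "sets (ks i x) = sets Y" for i
    using measure_kernel_sets[OF m x] measure_kernel_space[OF m x] measure_kernel_sets[OF mk x] by auto
  have "\<exists>A. i \<noteq> j \<longrightarrow> A \<in> sets Y \<and> emeasure (ks i x) (space Y - A) = 0 \<and> emeasure (ks j x) A = 0" for i j
  proof (cases "i = j")
    case False
    from sing[OF this] obtain A where A: "A \<in> sets (X \<Otimes>\<^sub>M Y)"
      "emeasure (ks i x) (space Y - {y. (x, y) \<in> A}) = 0"
      "emeasure (ks j x) (space Y - {y. (x, y) \<in> space X \<times> space Y - A}) = 0"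
      using x unfolding mutually_singular_kernels_def kernel_supported_in_def by blast
    have "Pair x -` A \<in> sets Y" using A(1) by (rule sets_Pair1)
    moreover have "{y. (x, y) \<in> A} = Pair x -` A" by auto
    moreover have "space Y - {y. (x, y) \<in> space X \<times> space Y - A} = Pair x -` A"
      using x sets.sets_into_space[OF \<open>Pair x -` A \<in> sets Y\<close>] by auto
    ultimately show ?thesis using A by metis
  qed simp
  then obtain A where A: "\<And>i j. i \<noteq> j \<Longrightarrow> A i j \<in> sets Y"
    "\<And>i j. i \<noteq> j \<Longrightarrow> emeasure (ks i x) (space Y - A i j) = 0"
    "\<And>i j. i \<noteq> j \<Longrightarrow> emeasure (ks j x) (A i j) = 0"
    by metis
  \<comment> \<open>This is the intersection of the sets \<open>A i j\<close> over all j other than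
    i, taken within \<open>space Y\<close>; its complement is a countable union of null sets of
    \<open>ks i x\<close>.\<close>
  define E where "E i = space Y - (\<Union>j\<in>-{i}. space Y - A i j)" for i
  have E: "E i \<in> sets Y" for i
    unfolding E_def using A(1) by (intro sets.Diff sets.countable_UN') auto
  have "emeasure (\<mu> x) (E i) \<noteq> \<infinity>" for i
  proof -
    have "emeasure (ks j x) (E i) = 0" if "j \<noteq> i" for j
    proof -
      have "emeasure (ks j x) (E i) \<le> emeasure (ks j x) (A i j)"
        using A(1)[of i j] S that by (intro emeasure_mono) (auto simp: E_def)
      then show ?thesis using A(3)[of i j] that by simp
    qed
    then have "(\<Sum>j. emeasure (ks j x) (E i)) = emeasure (ks i x) (E i)"
      by (subst suminf_finite[of "{i}"]) auto
    moreover have "emeasure (ks i x) (E i) \<noteq> \<infinity>"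
      using finite_measure.emeasure_finite[OF finite_kernel_finite_measure[OF ks x]] by simp
    ultimately show ?thesis using sums x E unfolding kernel_sums_def by simp
  qed
  moreover define R where "R = space Y - (\<Union>i. E i)"
  have R: "R \<in> sets Y" unfolding R_def using E by auto
  have "emeasure (ks i x) R = 0" for i
  proof -
    have "emeasure (ks i x) R \<le> emeasure (ks i x) (\<Union>j\<in>-{i}. space Y - A i j)"
      using A(1) S by (intro emeasure_mono sets.countable_UN') (auto simp: R_def E_def)
    also have "(\<Union>j\<in>-{i}. space Y - A i j) \<in> null_sets (ks i x)"
      using A(1,2) S by (intro null_sets_UN') auto
    then have "emeasure (ks i x) (\<Union>j\<in>-{i}. space Y - A i j) = 0" by auto
    finally show ?thesis by simp
  qed
  then have "emeasure (\<mu> x) R = 0" using sums x R unfolding kernel_sums_def by simp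
  ultimately show ?thesis
    \<comment> \<open>The countable cover by sets of finite measure consists of the
      \<open>E i\<close> and the null set \<open>R\<close>.\<close>
    using E R S by unfold_locales (intro exI[of _ "insert R (range E)"], auto simp: R_def dest: sets.sets_into_space)
qed

section \<open>Uniqueness of the representation for a single measure\<close>

lemma emeasure_density_const_on:
  assumes "f \<in> borel_measurable M" "A \<in> sets M" "\<And>x. x \<in> A \<Longrightarrow> f x = c"
  shows "emeasure (density M f) A = c * emeasure M A"
proof -
  have "emeasure (density M f) A = (\<integral>\<^sup>+x. c * indicator A x \<partial>M)"
    using assms by (subst emeasure_density) (auto intro!: nn_integral_cong simp: indicator_def)
  then show ?thesis using assms(2) by (simp add: nn_integral_cmult_indicator)
qed

text \<open>On \<open>A\<close> the common measure agrees with \<open>M\<close>, which is finite on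
  each piece of an exhausting sequence, and also with infinity times \<open>M'\<close>, which takes
  only the values 0 and infinity. Hence it is 0 on each piece of \<open>A\<close>.\<close>

lemma density_one_infinity_disagreement_null:
  assumes M: "sigma_finite_measure M"
    and f: "f \<in> borel_measurable M" and f': "f' \<in> borel_measurable M'"
    and eq: "density M f = density M' f'"
    and A: "A \<in> sets M" "\<And>x. x \<in> A \<Longrightarrow> f x = 1" "\<And>x. x \<in> A \<Longrightarrow> f' x = \<infinity>"
  shows "emeasure (density M f) A = 0"
proof -
  interpret sigma_finite_measure M by fact
  have S: "sets M = sets M'" using arg_cong[OF eq, of sets] by simp
  obtain C :: "nat \<Rightarrow> 'a set" where C: "range C \<subseteq> sets M" "(\<Union>i. C i) = space M" "\<And>i. emeasure M (C i) \<noteq> \<infinity>"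
    using sigma_finite by blast
  have AC: "A \<inter> C i \<in> sets M" for i using A C by auto
  have "emeasure (density M f) (A \<inter> C i) = 0" for i
  proof -
    have 1: "emeasure (density M f) (A \<inter> C i) = 1 * emeasure M (A \<inter> C i)"
      using f AC A by (intro emeasure_density_const_on) auto
    have 2: "emeasure (density M f) (A \<inter> C i) = \<infinity> * emeasure M' (A \<inter> C i)"
      unfolding eq using f' AC A S by (intro emeasure_density_const_on) auto
    have "emeasure M (A \<inter> C i) \<le> emeasure M (C i)" using C by (intro emeasure_mono) auto
    then have "emeasure M (A \<inter> C i) \<noteq> \<infinity>" using C(3) neq_top_trans by auto
    with 1 2 have "emeasure M' (A \<inter> C i) = 0" by (auto simp: ennreal_top_mult split: if_splits)
    then show ?thesis using 2 by simp
  qed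
  then have "emeasure (density M f) (\<Union>i. A \<inter> C i) = 0"
    using AC by (intro emeasure_UN_eq_0) auto
  also have "(\<Union>i. A \<inter> C i) = A" using C(2) sets.sets_into_space[OF A(1)] by auto
  finally show ?thesis .
qed

text \<open>The functions can differ only on \<open>E\<close> and \<open>E'\<close>, which are null
  by the previous lemma applied in both directions. For the second claim, f is 1 on
  \<open>A\<close>; outside \<open>E\<close> both densities are 1, so \<open>M\<close> and
  \<open>M'\<close> agree there, and \<open>A \<inter> E\<close> is null for each of them.\<close>

lemma density_one_infinity_unique:
  assumes M: "sigma_finite_measure M" and M': "sigma_finite_measure M'"
    and f: "f \<in> borel_measurable M" "f \<in> space M \<rightarrow> {1, \<infinity>}"
    and f': "f' \<in> borel_measurable M'" "f' \<in> space M' \<rightarrow> {1, \<infinity>}"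
    and eq: "density M f = density M' f'"
  shows "AE x in density M f. f x = f' x"
    and "\<And>A. A \<in> sets M \<Longrightarrow> \<forall>x\<in>A. f x \<noteq> \<infinity> \<Longrightarrow> emeasure M A = emeasure M' A"
proof -
  have S: "sets M' = sets M" "space M' = space M"
    using arg_cong[OF eq, of sets] arg_cong[OF eq, of space] by simp_all
  note [measurable] = f(1)
  have [measurable]: "f' \<in> borel_measurable M" using f'(1) measurable_cong_sets[OF S(1) refl] by blast
  have f_or: "f x = 1 \<or> f x = \<infinity>" "f' x = 1 \<or> f' x = \<infinity>" if "x \<in> space M" for x
    using f(2) f'(2) S that by auto
  define E where "E = {x \<in> space M. f x = 1 \<and> f' x = \<infinity>}"
  define E' where "E' = {x \<in> space M. f x = \<infinity> \<and> f' x = 1}"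
  have [measurable]: "E \<in> sets M" "E' \<in> sets M" unfolding E_def E'_def by measurable
  have E0: "emeasure (density M f) E = 0"
    by (rule density_one_infinity_disagreement_null[OF M f(1) f'(1) eq]) (auto simp: E_def[symmetric], auto simp: E_def)
  have "emeasure (density M' f') E' = 0"
    by (rule density_one_infinity_disagreement_null[OF M' f'(1) f(1) eq[symmetric]]) (auto simp: S, auto simp: E'_def)
  then have E'0: "emeasure (density M f) E' = 0" by (simp add: eq)
  show "AE x in density M f. f x = f' x"
  proof (rule AE_I[of _ _ "E \<union> E'"])
    show "{x \<in> space (density M f). f x \<noteq> f' x} \<subseteq> E \<union> E'"
      using f_or by (force simp: E_def E'_def)
    show "emeasure (density M f) (E \<union> E') = 0"
      using E0 E'0 by (subst emeasure_Un_null_set) (auto simp: null_sets_def)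
  qed auto
  fix A assume A[measurable]: "A \<in> sets M" and fA: "\<forall>x\<in>A. f x \<noteq> \<infinity>"
  have AM: "A \<subseteq> space M" using A by (rule sets.sets_into_space)
  have EA[measurable]: "A \<inter> E \<in> sets M" "A - E \<in> sets M" by measurable
  have split: "A = (A - E) \<union> (A \<inter> E)" by auto
  have f1: "f x = 1" if "x \<in> A" for x using fA f_or AM that by blast
  have 0: "emeasure (density M f) (A \<inter> E) = 0"
    using E0 emeasure_mono[of "A \<inter> E" E "density M f"] by simp
  \<comment> \<open>On \<open>E\<close> the common measure is infinity times \<open>M'\<close>, so
    its vanishing forces \<open>M'\<close> to vanish as well.\<close>
  have "emeasure (density M f) (A \<inter> E) = \<infinity> * emeasure M' (A \<inter> E)"
    unfolding eq using f'(1) S by (intro emeasure_density_const_on) (auto simp: E_def)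
  with 0 have 1: "emeasure M' (A \<inter> E) = 0" by auto
  have "emeasure M A = emeasure (density M f) A"
    using f(1) f1 emeasure_density_const_on[of f M A 1] by simp
  also have "\<dots> = emeasure (density M f) (A - E)"
    using 0 by (subst split, subst emeasure_Un_null_set) (auto simp: null_sets_def)
  also have "\<dots> = 1 * emeasure M' (A - E)"
    unfolding eq
  proof (intro emeasure_density_const_on f')
    fix x assume "x \<in> A - E"
    then show "f' x = 1" using f1 f_or(2)[of x] AM by (auto simp: E_def)
  qed (simp add: S)
  also have "\<dots> = emeasure M' A"
    using 1 S by (subst (2) split, subst emeasure_Un_null_set) (auto simp: null_sets_def)
  finally show "emeasure M A = emeasure M' A" .
qed

theorem theorem7:
  fixes X :: "'a measure" and Y :: "'b measure" and \<nu> :: "'a \<Rightarrow> 'b measure"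
  assumes "countable_discrete_space X \<or> standard_borel_space Y"
    and "measure_kernel X Y \<nu>"
  shows "(s_finite_kernel X Y \<nu> \<longleftrightarrow>
           (\<exists>\<mu> f. sigma_finite_kernel X Y \<mu> \<and>
                  f \<in> borel_measurable (X \<Otimes>\<^sub>M Y) \<and> f \<in> space (X \<Otimes>\<^sub>M Y) \<rightarrow> {1, \<infinity>} \<and>
                  (\<forall>x\<in>space X. \<nu> x = kernel_density \<mu> f x))) \<and>
         (\<forall>\<mu> \<mu>' f f'.
           sigma_finite_kernel X Y \<mu> \<and> sigma_finite_kernel X Y \<mu>' \<and>
           f \<in> borel_measurable (X \<Otimes>\<^sub>M Y) \<and> f \<in> space (X \<Otimes>\<^sub>M Y) \<rightarrow> {1, \<infinity>} \<and>
           f' \<in> borel_measurable (X \<Otimes>\<^sub>M Y) \<and> f' \<in> space (X \<Otimes>\<^sub>M Y) \<rightarrow> {1, \<infinity>} \<and>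
           (\<forall>x\<in>space X. \<nu> x = kernel_density \<mu> f x) \<and>
           (\<forall>x\<in>space X. \<nu> x = kernel_density \<mu>' f' x) \<longrightarrow>
           (\<forall>x\<in>space X. AE y in \<nu> x. f (x, y) = f' (x, y)) \<and>
           (\<forall>x\<in>space X. \<forall>A\<in>sets Y.
              (\<forall>y\<in>A. f (x, y) \<noteq> \<infinity>) \<longrightarrow> emeasure (\<mu> x) A = emeasure (\<mu>' x) A))"
proof (intro conjI iffI allI impI)
  show "\<exists>\<mu> f. sigma_finite_kernel X Y \<mu> \<and>
      f \<in> borel_measurable (X \<Otimes>\<^sub>M Y) \<and> f \<in> space (X \<Otimes>\<^sub>M Y) \<rightarrow> {1, \<infinity>} \<and>
      (\<forall>x\<in>space X. \<nu> x = kernel_density \<mu> f x)" if "s_finite_kernel X Y \<nu>"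
    using s_finite_kernel_decomposition[OF assms(1) that] .
  show "s_finite_kernel X Y \<nu>" if "\<exists>\<mu> f. sigma_finite_kernel X Y \<mu> \<and>
      f \<in> borel_measurable (X \<Otimes>\<^sub>M Y) \<and> f \<in> space (X \<Otimes>\<^sub>M Y) \<rightarrow> {1, \<infinity>} \<and>
      (\<forall>x\<in>space X. \<nu> x = kernel_density \<mu> f x)"
    using that s_finite_kernel_density[OF sigma_finite_kernel_imp_s_finite_kernel _ _ assms(2)] by blast
next
  fix \<mu> \<mu>' f f'
  assume asm: "sigma_finite_kernel X Y \<mu> \<and> sigma_finite_kernel X Y \<mu>' \<and>
      f \<in> borel_measurable (X \<Otimes>\<^sub>M Y) \<and> f \<in> space (X \<Otimes>\<^sub>M Y) \<rightarrow> {1, \<infinity>} \<and>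
      f' \<in> borel_measurable (X \<Otimes>\<^sub>M Y) \<and> f' \<in> space (X \<Otimes>\<^sub>M Y) \<rightarrow> {1, \<infinity>} \<and>
      (\<forall>x\<in>space X. \<nu> x = kernel_density \<mu> f x) \<and>
      (\<forall>x\<in>space X. \<nu> x = kernel_density \<mu>' f' x)"
  then have m: "measure_kernel X Y \<mu>" "measure_kernel X Y \<mu>'" by (auto simp: sigma_finite_kernel_def)
  \<comment> \<open>Uniqueness is a claim about each x separately. Only \<sigma>-finiteness of the
    two measures at x and measurability of the sections of f and f' have to be carried over from the
    kernels.\<close>
  have *: "(AE y in \<nu> x. f (x, y) = f' (x, y)) \<and>
      (\<forall>A\<in>sets Y. (\<forall>y\<in>A. f (x, y) \<noteq> \<infinity>) \<longrightarrow> emeasure (\<mu> x) A = emeasure (\<mu>' x) A)"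
    if x: "x \<in> space X" for x
  proof -
    have n: "\<nu> x = density (\<mu> x) (\<lambda>y. f (x, y))" "\<nu> x = density (\<mu>' x) (\<lambda>y. f' (x, y))"
      using asm x by (auto simp: kernel_density_def)
    have "sigma_finite_measure (\<mu> x)" "sigma_finite_measure (\<mu>' x)"
      using asm x by (auto intro: sigma_finite_kernel_sigma_finite_measure)
    moreover have "(\<lambda>y. f (x, y)) \<in> borel_measurable (\<mu> x)" "(\<lambda>y. f' (x, y)) \<in> borel_measurable (\<mu>' x)"
      using asm m x by (auto intro: measurable_kernel_section)
    moreover have "(\<lambda>y. f (x, y)) \<in> space (\<mu> x) \<rightarrow> {1, \<infinity>}" "(\<lambda>y. f' (x, y)) \<in> space (\<mu>' x) \<rightarrow> {1, \<infinity>}"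
      using asm x measure_kernel_space[OF m(1) x] measure_kernel_space[OF m(2) x]
      by (auto simp: space_pair_measure Pi_iff)
    moreover have "density (\<mu> x) (\<lambda>y. f (x, y)) = density (\<mu>' x) (\<lambda>y. f' (x, y))" using n by simp
    ultimately show ?thesis
      unfolding n(1)
      using density_one_infinity_unique[of "\<mu> x" "\<mu>' x" "\<lambda>y. f (x, y)" "\<lambda>y. f' (x, y)"]
        measure_kernel_sets[OF m(1) x] by simp
  qed
  show "\<forall>x\<in>space X. AE y in \<nu> x. f (x, y) = f' (x, y)" using * by blast
  show "\<forall>x\<in>space X. \<forall>A\<in>sets Y. (\<forall>y\<in>A. f (x, y) \<noteq> \<infinity>) \<longrightarrow> emeasure (\<mu> x) A = emeasure (\<mu>' x) A"
    using * by blast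
qed

end
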